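(* Let $p>0$ satisfy $2/p\in\mathbb{N}$ and let $\varphi\in[0,2\pi)$. Then for every $r\geq0$ and every $\omega>0$, $$\mathcal{J}_{\omega,\varphi}^{[p]}(r)=\frac{(\frac2p)^2 r^{\omega}}{p^{\omega-1}\Gamma(\omega)\Gamma(\frac1p)^2}\int_0^1\Bigl(\int_0^1\cos\bigl(r(s(1-u^p)\cos^{2/p}\varphi)^{1/p}\bigr)s^{\frac1p-1}(1-s)^{\omega-1}\,ds\Bigr)\cos(ru\sin^{2/p}\varphi)(1-u^p)^{\frac1p+\omega-1}\,du,$$ and $$\mathcal{J}_{0,\varphi}^{[p]}(r)=\frac{4}{p\,\Gamma(\frac1p)^2}\int_0^1\cos\bigl(r(1-u^p)^{1/p}\cos^{2/p}\varphi\bigr)\cos(ru\sin^{2/p}\varphi)(1-u^p)^{\frac1p-1}\,du.$$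
   Context: For $p>0$ with $2/p\in\mathbb{N}$, real order $\omega\geq0$ and angle $\varphi\in[0,2\pi)$, the $p$-Bessel function is defined for $r\ge 0$ by $$\mathcal{J}_{\omega,\varphi}^{[p]}(r)=\Bigl(\frac{2}{p}\Bigr)^{2+\omega}\frac{\pi}{\Gamma(\frac1p)^2}\sum_{k=0}^{\infty}\frac{(-1)^k}{k!\,\Gamma(\frac2p(k+1)+\omega)}\Bigl(\frac r2\Bigr)^{2k+\omega}\Phi_{k,\varphi}^{[p]},$$ $$\Phi_{k,\varphi}^{[p]}=\sum_{n=0}^{k}\frac{(\frac2p(k+1)-1)!}{n!\,(k-n)!}\,\frac{B(\frac2p(n+\frac12),\frac2p(k-n+\frac12))}{B(n+\frac12,k-n+\frac12)}\,(\cos^{4/p}\varphi)^n(\sin^{4/p}\varphi)^{k-n},$$ where $B$ is the Beta function. Since $2/p$ is a positive integer, $\cos^{2/p}\varphi$ and $\sin^{2/p}\varphi$ denote ordinary integer powers.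
   Formalization: In the first formula the factor cos^{2/p}φ is moved outside the 1/p-th power: the inner cosine is cos(r (s(1-u^p))^{1/p} cos^{2/p}φ). As printed the identity fails, e.g. for p=2, φ=π/3 and small r>0; for p=1 both forms agree. *)

theory Defs
  imports "HOL-Analysis.Analysis"
begin

text \<open>
  Real power of a nonnegative base with the convention \<open>0\<^sup>0 = 1\<close>. The library's \<open>powr\<close> has
  \<open>0 powr 0 = 0\<close>, which would make the \<open>k = 0\<close> term of the series below vanish at
  \<open>\<omega> = 0\<close>, \<open>r = 0\<close>.
\<close>

definition rpow :: "real \<Rightarrow> real \<Rightarrow> real" where
  "rpow x a = (if a = 0 then 1 else x powr a)"

text \<open>
  The value \<open>2/p\<close> as a natural number; only meaningful under the assumption \<open>2/p \<in> \<nat>\<close>. Then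
  \<open>cos \<phi> ^ two_over p\<close> is the ordinary integer power, also when \<open>cos \<phi>\<close> is negative, and
  \<open>cos \<phi> ^ (2 * two_over p)\<close> is the one with exponent \<open>4/p\<close>.
\<close>

definition two_over :: "real \<Rightarrow> nat" where
  "two_over p = nat \<lfloor>2 / p\<rfloor>"

definition p_Bessel_Phi :: "real \<Rightarrow> nat \<Rightarrow> real \<Rightarrow> real" where
  "p_Bessel_Phi p k \<phi> =
     (\<Sum>n=0..k. fact (two_over p * (k + 1) - 1) / (fact n * fact (k - n))
        * (Beta (2 / p * (real n + 1 / 2)) (2 / p * (real (k - n) + 1 / 2))
           / Beta (real n + 1 / 2) (real (k - n) + 1 / 2))
        * (cos \<phi> ^ (2 * two_over p)) ^ n * (sin \<phi> ^ (2 * two_over p)) ^ (k - n))"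

definition p_Bessel :: "real \<Rightarrow> real \<Rightarrow> real \<Rightarrow> real \<Rightarrow> real" where
  "p_Bessel p \<omega> \<phi> r =
     (2 / p) powr (2 + \<omega>) * (pi / (Gamma (1 / p))\<^sup>2)
     * (\<Sum>k. (-1) ^ k / (fact k * Gamma (2 / p * (real k + 1) + \<omega>))
          * rpow (r / 2) (2 * real k + \<omega>) * p_Bessel_Phi p k \<phi>)"

end

theory Submission
  imports Defs
begin

text \<open>
  Let \<open>q = 2 / p\<close>. Expand both cosines into their power series and integrate termwise. The inner
  integral of the \<open>n\<close>th term is a Beta integral, and so is the outer one after substituting
  \<open>v = u powr p\<close>; the factor \<open>Gamma (q (n + 1/2) + \<omega>)\<close> cancels in the product of the two. The
  Cauchy product of the two series is the series of the \<open>p\<close>-Bessel function, because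
  \<open>n! Gamma (n + 1/2) = (2n)! sqrt \<pi> / 4\<^sup>n\<close> turns the factorials and the Beta function in the
  denominator of \<open>p_Bessel_Phi\<close> into the coefficients of the cosine.
\<close>

section \<open>Lebesgue integrals and termwise integration against a weight\<close>

text \<open>Carries Beta integrals known as \<open>has_integral\<close> over to
  \<open>lborel\<close>. Nonnegativity upgrades gauge integrability to absolute integrability, and
  for Borel data the integrals over \<open>lebesgue\<close> and \<open>lborel\<close> agree.\<close>

lemma has_integral_nonneg_imp_lborel:
  fixes f :: "real \<Rightarrow> real"
  assumes "(f has_integral I) S" "f \<in> borel_measurable borel" "S \<in> sets borel"
    and "\<And>x. x \<in> S \<Longrightarrow> f x \<ge> 0"
  shows "set_integrable lborel S f" "(LBINT x:S. f x) = I"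
proof -
  have meas: "(\<lambda>x. indicator S x *\<^sub>R f x) \<in> borel_measurable lborel"
    using assms(2,3) by simp
  have abs: "f absolutely_integrable_on S"
    using assms by (intro nonnegative_absolutely_integrable_1) (auto simp: integrable_on_def)
  then show "set_integrable lborel S f"
    using integrable_completion[OF meas] by (simp add: set_integrable_def)
  have "(LBINT x:S. f x) = (LINT x:S|lebesgue. f x)"
    using integral_completion[OF meas] by (simp add: set_lebesgue_integral_def)
  also have "\<dots> = I"
    using set_lebesgue_integral_eq_integral(2)[OF abs] assms(1) by (simp add: integral_unique)
  finally show "(LBINT x:S. f x) = I" .
qed

text \<open>The integral of \<open>\<bar>g k x * w x\<bar>\<close> is at most \<open>c k\<close>
  times the integral of \<open>w\<close>, so these integrals are summable and
  \<open>sums_integral\<close> applies. The weight is split off because it may be unbounded at the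
  ends of the interval, while the power series terms are uniformly bounded.\<close>

lemma set_integral_sums_weighted:
  fixes g :: "nat \<Rightarrow> real \<Rightarrow> real"
  assumes w: "set_integrable lborel A w" "\<And>x. x \<in> A \<Longrightarrow> w x \<ge> 0" and A: "A \<in> sets borel"
    and g: "\<And>k. g k \<in> borel_measurable borel"
    and bound: "\<And>k x. x \<in> A \<Longrightarrow> \<bar>g k x\<bar> \<le> c k" and c: "summable c"
  shows "(\<lambda>k. LBINT x:A. g k x * w x) sums (LBINT x:A. (\<Sum>k. g k x) * w x)"
proof -
  \<comment> \<open>Extending the weight by zero makes nonnegativity and the bound below hold on the
    whole line.\<close>
  define W where "W = (\<lambda>x. indicator A x * w x)"
  have W: "integrable lborel W" "\<And>x. W x \<ge> 0"
    using w by (auto simp: W_def set_integrable_def indicator_def)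
  have le: "norm (g k x * W x) \<le> c k * W x" for k x
    using bound[of x k] w(2)[of x] by (cases "x \<in> A") (auto simp: W_def abs_mult intro!: mult_right_mono)
  have int: "integrable lborel (\<lambda>x. g k x * W x)" for k
  proof (rule Bochner_Integration.integrable_bound)
    show "integrable lborel (\<lambda>x. c k * W x)" using W(1) by simp
    show "(\<lambda>x. g k x * W x) \<in> borel_measurable lborel"
      using g[of k] borel_measurable_integrable[OF W(1)] by simp
    show "AE x in lborel. norm (g k x * W x) \<le> norm (c k * W x)"
      using order_trans[OF le abs_ge_self] by simp
  qed
  have sm: "summable (\<lambda>k. norm (g k x * W x))" for x
    by (rule summable_comparison_test'[where g = "\<lambda>k. c k * W x"])
       (use le c in \<open>auto intro: summable_mult2\<close>)
  have "(\<lambda>k. LINT x|lborel. g k x * W x) sums (LINT x|lborel. (\<Sum>k. g k x * W x))"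
  proof (rule sums_integral[OF int])
    show "AE x in lborel. summable (\<lambda>k. norm (g k x * W x))" using sm by simp
    have "(LINT x|lborel. norm (g k x * W x)) \<le> c k * (LINT x|lborel. W x)" for k
    proof -
      have "(LINT x|lborel. norm (g k x * W x)) \<le> (LINT x|lborel. c k * W x)"
        using int[of k] W(1) le by (intro integral_mono) auto
      then show ?thesis by simp
    qed
    then show "summable (\<lambda>k. LINT x|lborel. norm (g k x * W x))"
      by (intro summable_comparison_test'[OF summable_mult2[OF c]]) simp
  qed
  moreover have "(\<Sum>k. g k x * W x) = indicator A x *\<^sub>R ((\<Sum>k. g k x) * w x)" for x
  proof (cases "x \<in> A")
    case True
    have "summable (\<lambda>k. g k x)"
      by (rule summable_comparison_test'[OF c]) (use bound True in auto)
    then show ?thesis using True by (simp add: W_def suminf_mult2)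
  qed (simp add: W_def)
  ultimately show ?thesis
    by (simp add: set_lebesgue_integral_def W_def mult_ac)
qed

section \<open>Beta integrals with additional power factors\<close>

lemma set_integral_Beta_power:
  fixes a b :: real
  assumes "a > 0" "b > 0"
  shows "set_integrable lborel {0..1} (\<lambda>t. t powr (a - 1) * (1 - t) powr (b - 1))"
    and "(LBINT t:{0..1}. t ^ n * (t powr (a - 1) * (1 - t) powr (b - 1))) = Beta (a + n) b"
proof -
  show "set_integrable lborel {0..1} (\<lambda>t. t powr (a - 1) * (1 - t) powr (b - 1))"
    by (rule has_integral_nonneg_imp_lborel[OF has_integral_Beta_real[OF assms]]) auto
  have pos: "a + n > 0" using assms by simp
  \<comment> \<open>The power merges with the weight and shifts the first Beta parameter by
    \<open>n\<close>. At \<open>t = 0\<close> both sides vanish because \<open>0 powr x = 0\<close>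
    for every \<open>x\<close>.\<close>
  have eq: "t ^ n * (t powr (a - 1) * (1 - t) powr (b - 1)) =
      t powr (a + n - 1) * (1 - t) powr (b - 1)" if "t \<in> {0..1}" for t :: real
    using that by (cases "t = 0") (auto simp: powr_add powr_diff powr_realpow)
  have "(LBINT t:{0..1}. t ^ n * (t powr (a - 1) * (1 - t) powr (b - 1))) =
      (LBINT t:{0..1}. t powr (a + n - 1) * (1 - t) powr (b - 1))"
    by (rule set_lebesgue_integral_cong) (use eq in auto)
  also have "\<dots> = Beta (a + n) b"
    by (rule has_integral_nonneg_imp_lborel[OF has_integral_Beta_real[OF pos assms(2)]]) auto
  finally show "(LBINT t:{0..1}. t ^ n * (t powr (a - 1) * (1 - t) powr (b - 1))) = Beta (a + n) b" .
qed

text \<open>Substituting \<open>v = u powr p\<close> gives the Beta integrand: \<open>u ^ j\<close>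
  becomes \<open>v powr (j / p)\<close>, and the derivative of \<open>v powr (1 / p)\<close>
  contributes the factor \<open>1 / p\<close> and the exponent \<open>1 / p - 1\<close>.\<close>

lemma has_integral_Beta_powr_subst:
  fixes p b :: real
  assumes "p > 0" "b > 0"
  shows "((\<lambda>u. u ^ j * (1 - u powr p) powr (b - 1)) has_integral Beta ((real j + 1) / p) b / p) {0..1}"
proof -
  define f where "f = (\<lambda>u::real. u ^ j * (1 - u powr p) powr (b - 1))"
  define g where "g = (\<lambda>v::real. v powr (1 / p))"
  define g' where "g' = (\<lambda>v::real. (1 / p) * v powr (1 / p - 1))"
  \<comment> \<open>On the open interval \<open>g\<close> is differentiable everywhere; at
    \<open>0\<close> this fails for \<open>p > 1\<close>. The endpoints are restored at the end by
    \<open>has_integral_Icc_iff_Ioo\<close>.\<close>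
  let ?S = "{0<..<1::real}"
  have "u \<in> g ` ?S" if "u \<in> ?S" for u
  proof (rule image_eqI[of _ _ "u powr p"])
    show "u = g (u powr p)" using that assms by (simp add: g_def powr_powr)
    show "u powr p \<in> ?S" using that assms powr_less_mono2[of p u 1] by simp
  qed
  moreover have "g v \<in> ?S" if "v \<in> ?S" for v
    using that assms powr_less_mono2[of "1 / p" v 1] by (simp add: g_def)
  ultimately have im: "g ` ?S = ?S" by auto
  have inj: "inj_on g ?S"
    by (rule inj_on_inverseI[of _ "\<lambda>u. u powr p"]) (use assms in \<open>simp add: g_def powr_powr\<close>)
  have der: "(g has_field_derivative g' v) (at v within ?S)" if "v \<in> ?S" for v
    using that assms unfolding g_def g'_def
    by (auto intro!: derivative_eq_intros)
  have a: "(real j + 1) / p > 0" using assms by simp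
  have eq: "\<bar>g' v\<bar> * f (g v) = 1 / p * (v powr ((real j + 1) / p - 1) * (1 - v) powr (b - 1))"
    if "v \<in> ?S" for v
  proof -
    have "v powr (1 / p - 1) * (v powr (1 / p)) ^ j = v powr ((real j + 1) / p - 1)"
      using that by (simp add: powr_powr powr_realpow[symmetric] powr_add[symmetric] add_divide_distrib algebra_simps)
    then show ?thesis
      using that assms by (simp add: f_def g_def g'_def powr_powr abs_mult)
  qed
  have "((\<lambda>v. 1 / p * (v powr ((real j + 1) / p - 1) * (1 - v) powr (b - 1)))
      has_integral (1 / p * Beta ((real j + 1) / p) b)) ?S"
    using has_integral_mult_right[OF has_integral_Beta_real[OF a assms(2)], of "1 / p"]
    unfolding has_integral_Icc_iff_Ioo .
  then have hi: "((\<lambda>v. \<bar>g' v\<bar> * f (g v)) has_integral (Beta ((real j + 1) / p) b / p)) ?S"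
    by (subst has_integral_cong[OF eq]) auto
  moreover have "(\<lambda>v. \<bar>g' v\<bar> * f (g v)) absolutely_integrable_on ?S"
  proof (rule nonnegative_absolutely_integrable_1)
    show "(\<lambda>v. \<bar>g' v\<bar> * f (g v)) integrable_on ?S" using hi by (auto simp: integrable_on_def)
  qed (auto simp: f_def g_def)
  \<comment> \<open>The change of variables theorem is an equivalence; it is read from the
    \<open>v\<close> side, where the Beta integral is known, to the \<open>u\<close> side.\<close>
  ultimately have "f absolutely_integrable_on g ` ?S \<and> integral (g ` ?S) f = Beta ((real j + 1) / p) b / p"
    using has_absolute_integral_change_of_variables_1'[of ?S g g' f, OF _ der inj]
    by (auto simp: integral_unique)
  then have "(f has_integral (Beta ((real j + 1) / p) b / p)) ?S"
    unfolding im using set_lebesgue_integral_eq_integral(1) by (metis integrable_integral)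
  then show ?thesis by (simp add: has_integral_Icc_iff_Ioo f_def)
qed

text \<open>The factor \<open>(1 - u powr p) ^ i\<close> merges with the weight and raises the
  second Beta parameter to \<open>b + i\<close>. This is the shape of the terms in the product of
  the two cosine series.\<close>

lemma set_integral_Beta_powr_subst:
  fixes p b :: real
  assumes "p > 0" "b > 0"
  shows "set_integrable lborel {0..1} (\<lambda>u. u ^ j * ((1 - u powr p) ^ i * (1 - u powr p) powr (b - 1)))"
    and "(LBINT u:{0..1}. u ^ j * ((1 - u powr p) ^ i * (1 - u powr p) powr (b - 1))) =
      Beta ((real j + 1) / p) (b + i) / p"
proof -
  have b: "b + i > 0" using assms by simp
  have eq: "(1 - u powr p) ^ i * (1 - u powr p) powr (b - 1) = (1 - u powr p) powr (b + i - 1)"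
    if "u \<in> {0..1}" for u
    using that assms powr_le1[of p u]
    by (cases "u powr p = 1") (auto simp: powr_add powr_diff powr_realpow)
  have hi: "((\<lambda>u. u ^ j * ((1 - u powr p) ^ i * (1 - u powr p) powr (b - 1)))
      has_integral Beta ((real j + 1) / p) (b + i) / p) {0..1}"
    using has_integral_Beta_powr_subst[OF assms(1) b, of j]
    unfolding of_nat_add of_nat_1 by (rule has_integral_eq[rotated]) (use eq in auto)
  show "set_integrable lborel {0..1} (\<lambda>u. u ^ j * ((1 - u powr p) ^ i * (1 - u powr p) powr (b - 1)))"
    and "(LBINT u:{0..1}. u ^ j * ((1 - u powr p) ^ i * (1 - u powr p) powr (b - 1))) =
      Beta ((real j + 1) / p) (b + i) / p"
    using has_integral_nonneg_imp_lborel[OF hi] assms powr_le1[of p] by auto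
qed

section \<open>Integrating the product of two power series\<close>

text \<open>On the unit interval \<open>u\<close> and \<open>1 - u powr p\<close> both lie between 0
  and 1, so the Cauchy product of the two series is dominated by that of
  \<open>\<bar>a n\<bar>\<close> and \<open>\<bar>b n\<bar>\<close>, uniformly in \<open>u\<close>.
  Both outer integrals of the theorem are instances, with \<open>\<alpha> = q / 2 + \<omega>\<close>
  and \<open>\<alpha> = q / 2\<close>.\<close>

lemma power_series_product_integral_sums:
  fixes p \<alpha> :: real and a b :: "nat \<Rightarrow> real" and q :: nat
  assumes p: "p > 0" and \<alpha>: "\<alpha> > 0"
    and a: "summable (\<lambda>n. \<bar>a n\<bar>)" and b: "summable (\<lambda>n. \<bar>b n\<bar>)"
  shows "(\<lambda>k. \<Sum>n\<le>k. a n * b (k - n) * (Beta ((2 * real (k - n) + 1) / p) (\<alpha> + q * n) / p)) sums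
    (LBINT u:{0..1}. (\<Sum>n. a n * (1 - u powr p) ^ (q * n)) * (\<Sum>n. b n * u ^ (2 * n))
       * (1 - u powr p) powr (\<alpha> - 1))"
proof -
  let ?A = "\<lambda>u n. a n * (1 - u powr p) ^ (q * n)" and ?B = "\<lambda>u n. b n * u ^ (2 * n)"
  let ?w = "\<lambda>u. (1 - u powr p) powr (\<alpha> - 1)"
  have up: "u powr p \<in> {0..1}" if "u \<in> {0..1}" for u
    using that p powr_le1[of p u] by auto
  have leA: "\<bar>?A u n\<bar> \<le> \<bar>a n\<bar>" if "u \<in> {0..1}" for u n
    using up[OF that] by (auto simp: abs_mult power_abs intro!: mult_left_le power_le_one)
  have leB: "\<bar>?B u n\<bar> \<le> \<bar>b n\<bar>" if "u \<in> {0..1}" for u n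
    using that by (auto simp: abs_mult power_abs intro!: mult_left_le power_le_one)
  have "(\<lambda>k. LBINT u:{0..1}. (\<Sum>n\<le>k. ?A u n * ?B u (k - n)) * ?w u) sums
    (LBINT u:{0..1}. (\<Sum>k. \<Sum>n\<le>k. ?A u n * ?B u (k - n)) * ?w u)"
  proof (rule set_integral_sums_weighted)
    show "set_integrable lborel {0..1} ?w"
      using set_integral_Beta_powr_subst(1)[OF p \<alpha>, of 0 0] by simp
    show "summable (\<lambda>k. \<Sum>n\<le>k. \<bar>a n\<bar> * \<bar>b (k - n)\<bar>)"
      using a b by (intro summable_Cauchy_product) auto
    fix k and u :: real assume u: "u \<in> {0..1}"
    have "\<bar>\<Sum>n\<le>k. ?A u n * ?B u (k - n)\<bar> \<le> (\<Sum>n\<le>k. \<bar>?A u n * ?B u (k - n)\<bar>)"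
      by (rule sum_abs)
    also have "\<dots> \<le> (\<Sum>n\<le>k. \<bar>a n\<bar> * \<bar>b (k - n)\<bar>)"
      unfolding abs_mult[of "?A u _"] using leA[OF u] leB[OF u] by (intro sum_mono mult_mono) auto
    finally show "\<bar>\<Sum>n\<le>k. ?A u n * ?B u (k - n)\<bar> \<le> (\<Sum>n\<le>k. \<bar>a n\<bar> * \<bar>b (k - n)\<bar>)" .
  qed auto
  moreover have "(LBINT u:{0..1}. (\<Sum>k. \<Sum>n\<le>k. ?A u n * ?B u (k - n)) * ?w u) =
    (LBINT u:{0..1}. (\<Sum>n. ?A u n) * (\<Sum>n. ?B u n) * ?w u)"
  proof (rule set_lebesgue_integral_cong)
    show "\<forall>u. u \<in> {0..1} \<longrightarrow> (\<Sum>k. \<Sum>n\<le>k. ?A u n * ?B u (k - n)) * ?w u =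
      (\<Sum>n. ?A u n) * (\<Sum>n. ?B u n) * ?w u"
    proof (intro allI impI)
      fix u :: real assume u: "u \<in> {0..1}"
      have "summable (\<lambda>n. norm (?A u n))" "summable (\<lambda>n. norm (?B u n))"
        by (rule summable_comparison_test'[OF a], use leA[OF u] in simp,
            rule summable_comparison_test'[OF b], use leB[OF u] in simp)
      from Cauchy_product[OF this]
      show "(\<Sum>k. \<Sum>n\<le>k. ?A u n * ?B u (k - n)) * ?w u = (\<Sum>n. ?A u n) * (\<Sum>n. ?B u n) * ?w u"
        by simp
    qed
  qed auto
  moreover have "(LBINT u:{0..1}. (\<Sum>n\<le>k. ?A u n * ?B u (k - n)) * ?w u) =
    (\<Sum>n\<le>k. a n * b (k - n) * (Beta ((2 * real (k - n) + 1) / p) (\<alpha> + q * n) / p))" for k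
  proof -
    let ?f = "\<lambda>n u. u ^ (2 * (k - n)) * ((1 - u powr p) ^ (q * n) * ?w u)"
    have "(LBINT u:{0..1}. (\<Sum>n\<le>k. ?A u n * ?B u (k - n)) * ?w u) =
        (LINT u|lborel. (\<Sum>n\<le>k. a n * b (k - n) * (indicator {0..1} u *\<^sub>R ?f n u)))"
      unfolding set_lebesgue_integral_def
      by (intro Bochner_Integration.integral_cong refl) (simp add: sum_distrib_left sum_distrib_right mult_ac)
    also have "\<dots> = (\<Sum>n\<le>k. a n * b (k - n) * (LBINT u:{0..1}. ?f n u))"
      using set_integral_Beta_powr_subst(1)[OF p \<alpha>] unfolding set_lebesgue_integral_def set_integrable_def
      by (subst Bochner_Integration.integral_sum) auto
    finally show ?thesis
      by (simp add: set_integral_Beta_powr_subst(2)[OF p \<alpha>])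
  qed
  ultimately show ?thesis by simp
qed

section \<open>The cosine series and the inner integral\<close>

text \<open>For a fixed amplitude \<open>x\<close> this also serves as a coefficient sequence:
  \<open>cos_term x n * u ^ (2 * n)\<close> is the term of \<open>cos (x * u)\<close>.\<close>

definition cos_term :: "real \<Rightarrow> nat \<Rightarrow> real" where
  "cos_term x n = (-1) ^ n / fact (2 * n) * x ^ (2 * n)"

lemma cos_term_sums: "cos_term x sums cos x"
  using cos_paired[of x] by (simp add: cos_term_def[abs_def])

lemma cos_term_mult: "cos_term (x * y) n = cos_term x n * y ^ (2 * n)"
  by (simp add: cos_term_def power_mult_distrib)

lemma cos_mult_series: "(\<Sum>n. cos_term x n * u ^ (2 * n)) = cos (x * u)"
  using sums_unique[OF cos_term_sums[of "x * u"]] cos_term_mult[of x u] by presburger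

text \<open>Since \<open>fact n \<le> fact (2 * n)\<close>, the exponential series at
  \<open>x\<^sup>2\<close> dominates.\<close>

lemma summable_abs_cos_term: "summable (\<lambda>n. \<bar>cos_term x n\<bar>)"
proof (rule summable_comparison_test')
  show "summable (\<lambda>n. (x\<^sup>2) ^ n / fact n)"
    using summable_exp[of "x\<^sup>2"] by (simp add: field_simps)
  show "norm \<bar>cos_term x n\<bar> \<le> (x\<^sup>2) ^ n / fact n" for n
    unfolding cos_term_def abs_mult
    by (auto simp: abs_mult power_mult power_abs fact_mono intro!: divide_left_mono)
qed

text \<open>With \<open>1 / p = q / 2\<close>, only even powers of \<open>z powr (1 / p)\<close>
  occur in the cosine series, and these are integer powers of \<open>z\<close>. Positivity of
  \<open>q\<close> makes both sides agree at \<open>z = 0\<close>.\<close>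

lemma powr_half_power_even:
  fixes z :: real
  assumes "z \<ge> 0" "q > 0"
  shows "(z powr (real q / 2)) ^ (2 * n) = z ^ (q * n)"
  using assms
  by (cases "z = 0") (auto simp: powr_powr powr_realpow[symmetric] power_0_left)

text \<open>Expanding the cosine in powers of \<open>s ^ q\<close>, the \<open>n\<close>th term
  shifts the first Beta parameter from \<open>q / 2\<close> to \<open>q / 2 + q * n\<close>. The
  result is a power series in \<open>y ^ q\<close>, ready for
  \<open>y = 1 - u powr p\<close>.\<close>

lemma cos_Beta_integral:
  fixes \<omega> R :: real
  assumes \<omega>: "\<omega> > 0" and q: "q > 0"
  shows "summable (\<lambda>n. \<bar>cos_term R n * Beta (q / 2 + q * n) \<omega>\<bar>)"
    and "y \<ge> 0 \<Longrightarrow> y \<le> 1 \<Longrightarrow>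
      (LBINT s:{0..1}. cos (R * (s * y) powr (q / 2)) * s powr (q / 2 - 1) * (1 - s) powr (\<omega> - 1)) =
      (\<Sum>n. cos_term R n * Beta (q / 2 + q * n) \<omega> * y ^ (q * n))"
proof -
  let ?w = "\<lambda>s. s powr (q / 2 - 1) * (1 - s) powr (\<omega> - 1)"
  have q2: "real q / 2 > 0" using q by simp
  note B = set_integral_Beta_power[OF q2 \<omega>]
  have le: "\<bar>c * s ^ n\<bar> \<le> \<bar>c\<bar>" if "s \<in> {0..1}" for c s :: real and n
    using that by (auto simp: abs_mult power_abs intro!: mult_left_le power_le_one)
  \<comment> \<open>General in \<open>c\<close>, for two uses: the absolute values of the cosine
    coefficients give the summability claim, the coefficients scaled by \<open>y ^ (q * n)\<close>
    give the value of the integral.\<close>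
  have sums: "(\<lambda>n. c n * Beta (q / 2 + q * n) \<omega>) sums (LBINT s:{0..1}. (\<Sum>n. c n * s ^ (q * n)) * ?w s)"
    if "summable (\<lambda>n. \<bar>c n\<bar>)" for c :: "nat \<Rightarrow> real"
  proof -
    have "(\<lambda>n. LBINT s:{0..1}. c n * s ^ (q * n) * ?w s) sums
        (LBINT s:{0..1}. (\<Sum>n. c n * s ^ (q * n)) * ?w s)"
      by (rule set_integral_sums_weighted[OF B(1) _ _ _ le that]) auto
    moreover have "(LBINT s:{0..1}. c n * s ^ (q * n) * ?w s) = c n * Beta (q / 2 + q * n) \<omega>" for n
      using B(2)[of "q * n"] by (simp add: mult.assoc)
    ultimately show ?thesis by simp
  qed
  have "Beta (q / 2 + q * n) \<omega> \<ge> 0" for n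
    using \<omega> q by (auto simp: Beta_def intro!: divide_nonneg_nonneg mult_nonneg_nonneg Gamma_real_nonneg add_pos_nonneg)
  then show "summable (\<lambda>n. \<bar>cos_term R n * Beta (q / 2 + q * n) \<omega>\<bar>)"
    using sums_summable[OF sums[of "\<lambda>n. \<bar>cos_term R n\<bar>"]] summable_abs_cos_term
    by (simp add: abs_mult)
  assume y: "y \<ge> 0" "y \<le> 1"
  have "cos (R * (s * y) powr (q / 2)) = (\<Sum>n. cos_term R n * y ^ (q * n) * s ^ (q * n))"
    if "s \<in> {0..1}" for s
  proof -
    have "cos_term (R * (s * y) powr (q / 2)) n = cos_term R n * y ^ (q * n) * s ^ (q * n)" for n
      using that y q powr_half_power_even[of "s * y" q n]
      by (simp add: cos_term_mult power_mult_distrib)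
    then show ?thesis
      using sums_unique[OF cos_term_sums[of "R * (s * y) powr (q / 2)"]] by presburger
  qed
  then have "(LBINT s:{0..1}. cos (R * (s * y) powr (q / 2)) * s powr (q / 2 - 1) * (1 - s) powr (\<omega> - 1)) =
    (LBINT s:{0..1}. (\<Sum>n. cos_term R n * y ^ (q * n) * s ^ (q * n)) * ?w s)"
    by (intro set_lebesgue_integral_cong) (auto simp: mult.assoc)
  also have "\<dots> = (\<Sum>n. cos_term R n * y ^ (q * n) * Beta (q / 2 + q * n) \<omega>)"
  proof (rule sums_unique[OF sums])
    show "summable (\<lambda>n. \<bar>cos_term R n * y ^ (q * n)\<bar>)"
      by (rule summable_comparison_test'[OF summable_abs_cos_term[of R]]) (use le[of y] y in auto)
  qed
  finally show "(LBINT s:{0..1}. cos (R * (s * y) powr (q / 2)) * s powr (q / 2 - 1) * (1 - s) powr (\<omega> - 1)) =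
      (\<Sum>n. cos_term R n * Beta (q / 2 + q * n) \<omega> * y ^ (q * n))"
    by (simp add: mult_ac)
qed

section \<open>The coefficients of the \<open>p\<close>-Bessel series\<close>

text \<open>Legendre's duplication formula at integers. The induction step is
  \<open>(n + 1 / 2) * (n + 1) = (2 * n + 1) * (2 * n + 2) / 4\<close>.\<close>

lemma Gamma_half_fact:
  "Gamma (real n + 1 / 2) * fact n = fact (2 * n) * sqrt pi / 4 ^ n"
proof (induction n)
  case 0
  then show ?case by (simp add: Gamma_one_half_real)
next
  case (Suc n)
  have "Gamma (real (Suc n) + 1 / 2) = (real n + 1 / 2) * Gamma (real n + 1 / 2)"
    using Gamma_plus1[of "real n + 1 / 2"] nonpos_Ints_nonpos[of "real n + 1 / 2"]
    by (force simp: add_ac)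
  then have "Gamma (real (Suc n) + 1 / 2) * fact (Suc n) =
      (real n + 1 / 2) * real (Suc n) * (Gamma (real n + 1 / 2) * fact n)"
    by simp
  also have "\<dots> = fact (2 * Suc n) * sqrt pi / 4 ^ Suc n"
    unfolding Suc by (simp add: field_simps)
  finally show ?case .
qed

text \<open>The left side is the denominator of the \<open>n\<close>th summand of
  \<open>p_Bessel_Phi\<close>. The right side exhibits in it the denominators of the two cosine
  series; \<open>pi\<close> comes from the two factors \<open>sqrt pi\<close>.\<close>

lemma fact_mult_Gamma_half:
  assumes "n \<le> k"
  shows "fact n * fact (k - n) * Beta (real n + 1 / 2) (real (k - n) + 1 / 2) =
    fact (2 * n) * fact (2 * (k - n)) * pi / (4 ^ k * fact k)"
proof -
  have k: "real n + 1 / 2 + (real (k - n) + 1 / 2) = 1 + real k"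
    using assms by simp
  have "fact n * fact (k - n) * Beta (real n + 1 / 2) (real (k - n) + 1 / 2) =
      (Gamma (real n + 1 / 2) * fact n) * (Gamma (real (k - n) + 1 / 2) * fact (k - n)) / fact k"
    unfolding Beta_def k Gamma_fact by simp
  also have "\<dots> = fact (2 * n) * fact (2 * (k - n)) * pi / (4 ^ (n + (k - n)) * fact k)"
    unfolding Gamma_half_fact power_add by simp
  finally show ?thesis using assms by simp
qed

text \<open>Allows \<open>rpow (r / 2) \<omega>\<close> to leave the series. As
  \<open>\<omega> \<ge> 0\<close>, the exponent on the left is zero only if both its summands are,
  so the convention for exponent zero is consistent on both sides.\<close>

lemma rpow_add_even:
  assumes "x \<ge> 0" "\<omega> \<ge> 0"
  shows "rpow x (2 * real k + \<omega>) = x ^ (2 * k) * rpow x \<omega>"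
proof (cases "k = 0 \<or> x = 0")
  case True
  then show ?thesis using assms by (auto simp: rpow_def power_0_left)
next
  case False
  then have "x powr (2 * real k) = x ^ (2 * k)"
    using assms powr_realpow[of x "2 * k"] by simp
  then show ?thesis using assms False by (auto simp: rpow_def powr_add)
qed

text \<open>For \<open>\<omega> = 0\<close> this is the Beta function at
  \<open>q * (n + 1 / 2)\<close> and \<open>q * (j + 1 / 2)\<close>; for \<open>\<omega> > 0\<close>
  it is the three-variable Beta function with third argument \<open>\<omega>\<close>, divided by
  \<open>Gamma \<omega>\<close>.\<close>

definition p_Bessel_coeff :: "nat \<Rightarrow> real \<Rightarrow> nat \<Rightarrow> nat \<Rightarrow> real" where
  "p_Bessel_coeff q \<omega> n j =
     Gamma (q * (real n + 1 / 2)) * Gamma (q * (real j + 1 / 2)) / Gamma (q * (real (n + j) + 1) + \<omega>)"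

lemma p_Bessel_term:
  assumes q: "q > 0" and p: "p = 2 / real q" and "r \<ge> 0" "\<omega> \<ge> 0"
  shows "(-1) ^ k / (fact k * Gamma (2 / p * (real k + 1) + \<omega>))
       * rpow (r / 2) (2 * real k + \<omega>) * p_Bessel_Phi p k \<phi> =
    rpow (r / 2) \<omega> / pi * (\<Sum>n\<le>k. cos_term (r * cos \<phi> ^ q) n * cos_term (r * sin \<phi> ^ q) (k - n)
       * p_Bessel_coeff q \<omega> n (k - n))"
proof -
  have q2: "2 / p = q" and tq: "two_over p = q" using q by (simp_all add: p two_over_def)
  have "(-1) ^ k / (fact k * Gamma (q * (real k + 1) + \<omega>)) * ((r / 2) ^ (2 * k) * rpow (r / 2) \<omega>) *
      (fact (q * (k + 1) - 1) / (fact n * fact (k - n))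
        * (Beta (q * (real n + 1 / 2)) (q * (real (k - n) + 1 / 2))
           / Beta (real n + 1 / 2) (real (k - n) + 1 / 2))
        * (cos \<phi> ^ (2 * q)) ^ n * (sin \<phi> ^ (2 * q)) ^ (k - n)) =
    rpow (r / 2) \<omega> / pi * (cos_term (r * cos \<phi> ^ q) n * cos_term (r * sin \<phi> ^ q) (k - n)
       * p_Bessel_coeff q \<omega> n (k - n))" (is "?l = ?r") if "n \<le> k" for n
  proof -
    define j where "j = k - n"
    have k: "k = n + j" using that by (simp add: j_def)
    define A where "A = Gamma (q * (real n + 1 / 2)) * Gamma (q * (real j + 1 / 2))"
    define D where "D = Gamma (q * (real k + 1) + \<omega>)"
    \<comment> \<open>Since \<open>q > 0\<close>, the natural subtraction does not truncate, so the
      factorial is \<open>Gamma (q * (k + 1))\<close>.\<close>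
    have "real (q * (k + 1) - 1) = q * (real k + 1) - 1"
      using q by (simp add: of_nat_diff algebra_simps)
    then have F: "fact (q * (k + 1) - 1) = Gamma (q * (real k + 1))"
      by (metis Gamma_fact add_diff_cancel_left' diff_add_cancel add.commute)
    have pos: "Gamma (q * (real k + 1)) > 0" using q by simp
    have arg: "q * (real n + 1 / 2) + q * (real j + 1 / 2) = q * (real k + 1)"
      by (simp add: k algebra_simps)
    \<comment> \<open>The factorial in \<open>p_Bessel_Phi\<close> is exactly the denominator of
      this Beta value.\<close>
    have B: "fact (q * (k + 1) - 1) * Beta (q * (real n + 1 / 2)) (q * (real j + 1 / 2)) = A"
      unfolding F Beta_def arg A_def using pos by simp
    have rk: "(r / 2) ^ (2 * k) = r ^ (2 * n) * r ^ (2 * j) / 4 ^ k"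
      by (simp add: power_divide power_mult k power_add power_mult_distrib)
    have ck: "(cos \<phi> ^ (2 * q)) ^ n = (cos \<phi> ^ q) ^ (2 * n)"
      by (simp add: power_mult[symmetric] mult_ac)
    have sk: "(sin \<phi> ^ (2 * q)) ^ j = (sin \<phi> ^ q) ^ (2 * j)"
      by (simp add: power_mult[symmetric] mult_ac)
    have "?l = (-1) ^ k / (fact k * D) * (r / 2) ^ (2 * k) * rpow (r / 2) \<omega> *
        ((fact (q * (k + 1) - 1) * Beta (q * (real n + 1 / 2)) (q * (real j + 1 / 2)))
         / (fact n * fact j * Beta (real n + 1 / 2) (real j + 1 / 2)))
        * (cos \<phi> ^ (2 * q)) ^ n * (sin \<phi> ^ (2 * q)) ^ j"
      by (simp add: D_def j_def)
    also have "\<dots> = (-1) ^ k / (fact k * D) * (r / 2) ^ (2 * k) * rpow (r / 2) \<omega> *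
        (A / (fact (2 * n) * fact (2 * j) * pi / (4 ^ k * fact k)))
        * (cos \<phi> ^ (2 * q)) ^ n * (sin \<phi> ^ (2 * q)) ^ j"
      unfolding B fact_mult_Gamma_half[OF that, folded j_def] ..
    \<comment> \<open>Here \<open>fact k\<close> cancels, and \<open>4 ^ k\<close> cancels against
      the powers of 2 in \<open>(r / 2) ^ (2 * k)\<close>; the \<open>1 / pi\<close>
      remains.\<close>
    also have "\<dots> =
      rpow (r / 2) \<omega> / pi * ((-1) ^ n / fact (2 * n) * (r ^ (2 * n) * (cos \<phi> ^ q) ^ (2 * n)) *
        ((-1) ^ j / fact (2 * j) * (r ^ (2 * j) * (sin \<phi> ^ q) ^ (2 * j))) * (A / D))"
      unfolding rk ck sk by (simp add: k power_add mult_ac)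
    also have "\<dots> = ?r"
      by (simp add: cos_term_def j_def[symmetric] p_Bessel_coeff_def A_def D_def k power_mult_distrib)
    finally show ?thesis .
  qed
  then show ?thesis
    unfolding p_Bessel_Phi_def q2 tq atLeast0AtMost
    using assms(3,4) by (simp add: rpow_add_even sum_distrib_left)
qed

text \<open>Reduces both integral formulas to summing one Cauchy product. The \<open>pi\<close> in
  the prefactor of \<open>p_Bessel\<close> cancels the \<open>1 / pi\<close> of
  \<open>p_Bessel_term\<close>.\<close>

lemma p_Bessel_eqI:
  assumes q: "q > 0" and p: "p = 2 / real q" and "r \<ge> 0" "\<omega> \<ge> 0"
    and "(\<lambda>k. \<Sum>n\<le>k. cos_term (r * cos \<phi> ^ q) n * cos_term (r * sin \<phi> ^ q) (k - n)
       * p_Bessel_coeff q \<omega> n (k - n)) sums S"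
  shows "p_Bessel p \<omega> \<phi> r = (2 / p) powr (2 + \<omega>) * rpow (r / 2) \<omega> / (Gamma (1 / p))\<^sup>2 * S"
  unfolding p_Bessel_def p_Bessel_term[OF assms(1-4)]
    sums_unique[OF sums_mult[OF assms(5), of "rpow (r / 2) \<omega> / pi"], symmetric]
  by simp

section \<open>The two integral representations\<close>

lemma p_Bessel_integral_pos:
  assumes q: "q > 0" and p: "p = 2 / real q" and r: "r \<ge> 0" and \<omega>: "\<omega> > 0"
  shows "p_Bessel p \<omega> \<phi> r =
    (2 / p)\<^sup>2 * r powr \<omega> / (p powr (\<omega> - 1) * Gamma \<omega> * (Gamma (1 / p))\<^sup>2)
    * (LBINT u:{0..1}.
         (LBINT s:{0..1}.
            cos (r * (s * (1 - u powr p)) powr (1 / p) * cos \<phi> ^ q)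
            * s powr (1 / p - 1) * (1 - s) powr (\<omega> - 1))
         * cos (r * u * sin \<phi> ^ q) * (1 - u powr p) powr (1 / p + \<omega> - 1))"
    (is "_ = ?c * ?I")
proof -
  have pq: "1 / p = q / 2" "p > 0" using q by (simp_all add: p)
  \<comment> \<open>The coefficients of the inner integral as a power series in
    \<open>(1 - u powr p) ^ q\<close>; its Beta factors are absorbed here.\<close>
  define a where "a n = cos_term (r * cos \<phi> ^ q) n * Beta (q / 2 + q * n) \<omega>" for n
  define b where "b = cos_term (r * sin \<phi> ^ q)"
  have I: "?I = (LBINT u:{0..1}. (\<Sum>n. a n * (1 - u powr p) ^ (q * n)) * (\<Sum>n. b n * u ^ (2 * n))
       * (1 - u powr p) powr ((q / 2 + \<omega>) - 1))"
  proof (rule set_lebesgue_integral_cong)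
    show "\<forall>u. u \<in> {0..1} \<longrightarrow> (LBINT s:{0..1}.
            cos (r * (s * (1 - u powr p)) powr (1 / p) * cos \<phi> ^ q)
            * s powr (1 / p - 1) * (1 - s) powr (\<omega> - 1))
         * cos (r * u * sin \<phi> ^ q) * (1 - u powr p) powr (1 / p + \<omega> - 1) =
       (\<Sum>n. a n * (1 - u powr p) ^ (q * n)) * (\<Sum>n. b n * u ^ (2 * n))
       * (1 - u powr p) powr ((q / 2 + \<omega>) - 1)"
    proof (intro allI impI)
      fix u :: real assume "u \<in> {0..1}"
      then have "0 \<le> 1 - u powr p" "1 - u powr p \<le> 1" using pq powr_le1[of p u] by auto
      from cos_Beta_integral(2)[OF \<omega> q this, of "r * cos \<phi> ^ q"]
      show "(LBINT s:{0..1}.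
            cos (r * (s * (1 - u powr p)) powr (1 / p) * cos \<phi> ^ q)
            * s powr (1 / p - 1) * (1 - s) powr (\<omega> - 1))
         * cos (r * u * sin \<phi> ^ q) * (1 - u powr p) powr (1 / p + \<omega> - 1) =
       (\<Sum>n. a n * (1 - u powr p) ^ (q * n)) * (\<Sum>n. b n * u ^ (2 * n))
       * (1 - u powr p) powr ((q / 2 + \<omega>) - 1)"
        unfolding pq b_def cos_mult_series a_def by (simp only: mult_ac)
    qed
  qed auto
  have \<alpha>: "q / 2 + \<omega> > 0" using \<omega> by simp
  have ab: "summable (\<lambda>n. \<bar>a n\<bar>)" "summable (\<lambda>n. \<bar>b n\<bar>)"
    unfolding a_def b_def by (rule cos_Beta_integral[OF \<omega> q] summable_abs_cos_term)+
  have "(\<lambda>k. \<Sum>n\<le>k. a n * b (k - n) *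
      (Beta ((2 * real (k - n) + 1) / p) (q / 2 + \<omega> + q * n) / p)) sums ?I"
    unfolding I by (rule power_series_product_integral_sums[OF pq(2) \<alpha> ab])
  \<comment> \<open>The scaling removes the \<open>1 / p\<close> produced by the outer substitution
    and the \<open>Gamma \<omega>\<close> produced by the inner Beta integral.\<close>
  from sums_mult[OF this, of "p / Gamma \<omega>"]
  have "(\<lambda>k. p / Gamma \<omega> * (\<Sum>n\<le>k. a n * b (k - n) *
      (Beta ((2 * real (k - n) + 1) / p) (q / 2 + \<omega> + q * n) / p))) sums (p / Gamma \<omega> * ?I)" .
  moreover have "p / Gamma \<omega> * (\<Sum>n\<le>k. a n * b (k - n) *
      (Beta ((2 * real (k - n) + 1) / p) (q / 2 + \<omega> + q * n) / p)) =
    (\<Sum>n\<le>k. cos_term (r * cos \<phi> ^ q) n * cos_term (r * sin \<phi> ^ q) (k - n)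
       * p_Bessel_coeff q \<omega> n (k - n))" for k
    unfolding sum_distrib_left
  proof (rule sum.cong[OF refl])
    fix n assume n: "n \<in> {..k}"
    have e: "q / 2 + real (q * n) = q * (real n + 1 / 2)"
        "(2 * real (k - n) + 1) / p = q * (real (k - n) + 1 / 2)"
        "q / 2 + \<omega> + real (q * n) = q * (real n + 1 / 2) + \<omega>"
        "q * (real (k - n) + 1 / 2) + (q * (real n + 1 / 2) + \<omega>) = q * (real (n + (k - n)) + 1) + \<omega>"
      using q n by (simp_all add: p field_simps)
    \<comment> \<open>This Gamma value is the denominator of the inner Beta function and a numerator
      factor of the outer one; it must be nonzero to cancel.\<close>
    have "q * (real n + 1 / 2) + \<omega> > 0" using q \<omega> by (simp add: add_nonneg_pos)
    then have nz: "Gamma (q * (real n + 1 / 2) + \<omega>) \<noteq> 0" "Gamma \<omega> \<noteq> 0"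
      using \<omega> Gamma_real_pos by (metis less_irrefl)+
    show "p / Gamma \<omega> * (a n * b (k - n) *
      (Beta ((2 * real (k - n) + 1) / p) (q / 2 + \<omega> + q * n) / p)) =
      cos_term (r * cos \<phi> ^ q) n * cos_term (r * sin \<phi> ^ q) (k - n)
       * p_Bessel_coeff q \<omega> n (k - n)"
      unfolding a_def b_def e Beta_def p_Bessel_coeff_def using nz pq(2) by simp
  qed
  ultimately have "p_Bessel p \<omega> \<phi> r =
      (2 / p) powr (2 + \<omega>) * rpow (r / 2) \<omega> / (Gamma (1 / p))\<^sup>2 * (p / Gamma \<omega> * ?I)"
    using p_Bessel_eqI[OF q p r] \<omega> by simp
  \<comment> \<open>The factor \<open>2 powr \<omega>\<close> cancels between the prefactor and
    \<open>r / 2\<close>; afterwards \<open>p / p powr \<omega>\<close> gives the exponent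
    \<open>\<omega> - 1\<close>.\<close>
  also have "(2 / p) powr (2 + \<omega>) * rpow (r / 2) \<omega> = (2 / p)\<^sup>2 * r powr \<omega> / p powr \<omega>"
    using \<omega> r pq(2) by (simp add: rpow_def powr_add powr_divide power_divide)
  also have "\<dots> / (Gamma (1 / p))\<^sup>2 * (p / Gamma \<omega> * J) = ?c * J" for J
    using pq(2) by (simp add: powr_diff mult_ac)
  finally show ?thesis .
qed

text \<open>The first cosine series enters the outer integral directly, and the outer Beta value
  alone is already \<open>p_Bessel_coeff q 0\<close>, so scaling by \<open>p\<close>
  suffices.\<close>

lemma p_Bessel_integral_0:
  assumes q: "q > 0" and p: "p = 2 / real q" and r: "r \<ge> 0"
  shows "p_Bessel p 0 \<phi> r =
    4 / (p * (Gamma (1 / p))\<^sup>2)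
    * (LBINT u:{0..1}.
         cos (r * (1 - u powr p) powr (1 / p) * cos \<phi> ^ q)
         * cos (r * u * sin \<phi> ^ q) * (1 - u powr p) powr (1 / p - 1))"
    (is "_ = ?c * ?I")
proof -
  have pq: "1 / p = q / 2" "p > 0" using q by (simp_all add: p)
  define a where "a = cos_term (r * cos \<phi> ^ q)"
  define b where "b = cos_term (r * sin \<phi> ^ q)"
  have I: "?I = (LBINT u:{0..1}. (\<Sum>n. a n * (1 - u powr p) ^ (q * n)) * (\<Sum>n. b n * u ^ (2 * n))
       * (1 - u powr p) powr (q / 2 - 1))"
  proof (rule set_lebesgue_integral_cong)
    show "\<forall>u. u \<in> {0..1} \<longrightarrow> cos (r * (1 - u powr p) powr (1 / p) * cos \<phi> ^ q)
         * cos (r * u * sin \<phi> ^ q) * (1 - u powr p) powr (1 / p - 1) =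
       (\<Sum>n. a n * (1 - u powr p) ^ (q * n)) * (\<Sum>n. b n * u ^ (2 * n))
       * (1 - u powr p) powr (q / 2 - 1)"
    proof (intro allI impI)
      fix u :: real assume "u \<in> {0..1}"
      then have "0 \<le> 1 - u powr p" using pq powr_le1[of p u] by auto
      then have "(\<Sum>n. a n * (1 - u powr p) ^ (q * n)) =
          cos (r * cos \<phi> ^ q * (1 - u powr p) powr (q / 2))"
        using powr_half_power_even[OF _ q] cos_mult_series by (simp add: a_def flip: cos_mult_series)
      then show "cos (r * (1 - u powr p) powr (1 / p) * cos \<phi> ^ q)
         * cos (r * u * sin \<phi> ^ q) * (1 - u powr p) powr (1 / p - 1) =
       (\<Sum>n. a n * (1 - u powr p) ^ (q * n)) * (\<Sum>n. b n * u ^ (2 * n))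
       * (1 - u powr p) powr (q / 2 - 1)"
        unfolding pq b_def cos_mult_series by (simp only: mult_ac)
    qed
  qed auto
  have \<alpha>: "real q / 2 > 0" using q by simp
  have ab: "summable (\<lambda>n. \<bar>a n\<bar>)" "summable (\<lambda>n. \<bar>b n\<bar>)"
    unfolding a_def b_def by (rule summable_abs_cos_term)+
  have "(\<lambda>k. \<Sum>n\<le>k. a n * b (k - n) *
      (Beta ((2 * real (k - n) + 1) / p) (q / 2 + q * n) / p)) sums ?I"
    unfolding I by (rule power_series_product_integral_sums[OF pq(2) \<alpha> ab])
  from sums_mult[OF this, of p]
  have "(\<lambda>k. p * (\<Sum>n\<le>k. a n * b (k - n) *
      (Beta ((2 * real (k - n) + 1) / p) (q / 2 + q * n) / p))) sums (p * ?I)" .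
  moreover have "p * (\<Sum>n\<le>k. a n * b (k - n) *
      (Beta ((2 * real (k - n) + 1) / p) (q / 2 + q * n) / p)) =
    (\<Sum>n\<le>k. cos_term (r * cos \<phi> ^ q) n * cos_term (r * sin \<phi> ^ q) (k - n)
       * p_Bessel_coeff q 0 n (k - n))" for k
    unfolding sum_distrib_left
  proof (rule sum.cong[OF refl])
    fix n assume n: "n \<in> {..k}"
    have e: "q / 2 + real (q * n) = q * (real n + 1 / 2)"
        "(2 * real (k - n) + 1) / p = q * (real (k - n) + 1 / 2)"
        \<comment> \<open>The trailing \<open>+ 0\<close> is the slot of \<open>\<omega>\<close> in
          \<open>p_Bessel_coeff\<close>.\<close>
        "q * (real (k - n) + 1 / 2) + q * (real n + 1 / 2) = q * (real (n + (k - n)) + 1) + 0"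
      using q n by (simp_all add: p field_simps)
    show "p * (a n * b (k - n) *
      (Beta ((2 * real (k - n) + 1) / p) (q / 2 + q * n) / p)) =
      cos_term (r * cos \<phi> ^ q) n * cos_term (r * sin \<phi> ^ q) (k - n)
       * p_Bessel_coeff q 0 n (k - n)"
      unfolding a_def b_def e Beta_def p_Bessel_coeff_def using pq(2) by simp
  qed
  ultimately have "p_Bessel p 0 \<phi> r =
      (2 / p) powr (2 + 0) * rpow (r / 2) 0 / (Gamma (1 / p))\<^sup>2 * (p * ?I)"
    using p_Bessel_eqI[OF q p r, of 0] by simp
  also have "\<dots> = ?c * ?I"
    using pq(2) by (simp add: rpow_def power2_eq_square)
  finally show ?thesis .
qed

theorem theorem1p3:
  fixes p \<phi> :: real
  assumes "p > 0" and "2 / p \<in> \<nat>" and "0 \<le> \<phi>" and "\<phi> < 2 * pi"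
  shows "(\<forall>r \<omega> :: real. r \<ge> 0 \<longrightarrow> \<omega> > 0 \<longrightarrow>
            p_Bessel p \<omega> \<phi> r =
              (2 / p)\<^sup>2 * r powr \<omega> / (p powr (\<omega> - 1) * Gamma \<omega> * (Gamma (1 / p))\<^sup>2)
              * (LBINT u:{0..1}.
                   (LBINT s:{0..1}.
                      cos (r * (s * (1 - u powr p)) powr (1 / p) * cos \<phi> ^ two_over p)
                      * s powr (1 / p - 1) * (1 - s) powr (\<omega> - 1))
                   * cos (r * u * sin \<phi> ^ two_over p) * (1 - u powr p) powr (1 / p + \<omega> - 1)))
       \<and> (\<forall>r :: real. r \<ge> 0 \<longrightarrow>
            p_Bessel p 0 \<phi> r =
              4 / (p * (Gamma (1 / p))\<^sup>2)
              * (LBINT u:{0..1}.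
                   cos (r * (1 - u powr p) powr (1 / p) * cos \<phi> ^ two_over p)
                   * cos (r * u * sin \<phi> ^ two_over p) * (1 - u powr p) powr (1 / p - 1)))"
proof -
  obtain q where q: "2 / p = real q" using assms(2) by (auto elim: Nats_cases)
  then have q_pos: "q > 0" using assms(1) by (cases "q = 0") auto
  have p: "p = 2 / real q" using q q_pos assms(1) by (simp add: field_simps)
  have tq: "two_over p = q" using q by (simp add: two_over_def)
  show ?thesis
    unfolding tq using p_Bessel_integral_pos[OF q_pos p] p_Bessel_integral_0[OF q_pos p] by blast
qed

end
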